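(* Let $p$ be a prime and let $T$ be an abelian $p$-group (i.e. every element of $T$ has order a power of $p$). Then the following are equivalent: (a) $T$ is Bassian-finite. (b) $T$ is co-Hopfian. (c) $T$ is relatively co-Hopfian.
   Context: All groups are abelian, written additively. A group $G$ is Bassian-finite if there is no monomorphism from $G$ to any proper direct summand of $G$ (a direct summand different from $G$). A group $G$ is co-Hopfian if it is not isomorphic to any of its proper subgroups (equivalently, every injective endomorphism of $G$ is surjective). A group $G$ is relatively co-Hopfian if for every monomorphism $\phi:G\to G$, the subgroup $\phi(G)$ is essential in $G$, i.e. $\phi(G)\cap B\neq\{0\}$ for every non-zero subgroup $B\leq G$. *)

theory Defs
  imports "HOL-Algebra.Algebra"
begin

text \<open>
  Groups are those of HOL-Algebra, so the group operation is written multiplicatively, and a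
  subgroup \<open>H\<close> of \<open>G\<close>, regarded as a group, is \<open>G\<lparr>carrier := H\<rparr>\<close>. The definitions below are
  meant for commutative groups.
\<close>

definition direct_summand :: "'a set \<Rightarrow> ('a, 'b) monoid_scheme \<Rightarrow> bool" where
  "direct_summand A G \<longleftrightarrow> subgroup A G \<and>
     (\<exists>B. subgroup B G \<and> A \<inter> B = {\<one>\<^bsub>G\<^esub>} \<and> A <#>\<^bsub>G\<^esub> B = carrier G)"

definition bassian_finite :: "('a, 'b) monoid_scheme \<Rightarrow> bool" where
  "bassian_finite G \<longleftrightarrow>
     \<not> (\<exists>A. direct_summand A G \<and> A \<noteq> carrier G \<and> mon G (G\<lparr>carrier := A\<rparr>) \<noteq> {})"

definition co_hopfian :: "('a, 'b) monoid_scheme \<Rightarrow> bool" where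
  "co_hopfian G \<longleftrightarrow>
     \<not> (\<exists>H. subgroup H G \<and> H \<noteq> carrier G \<and> G \<cong> G\<lparr>carrier := H\<rparr>)"

definition essential_subgroup :: "'a set \<Rightarrow> ('a, 'b) monoid_scheme \<Rightarrow> bool" where
  "essential_subgroup H G \<longleftrightarrow> subgroup H G \<and>
     (\<forall>B. subgroup B G \<and> B \<noteq> {\<one>\<^bsub>G\<^esub>} \<longrightarrow> H \<inter> B \<noteq> {\<one>\<^bsub>G\<^esub>})"

definition relatively_co_hopfian :: "('a, 'b) monoid_scheme \<Rightarrow> bool" where
  "relatively_co_hopfian G \<longleftrightarrow> (\<forall>\<phi> \<in> mon G G. essential_subgroup (\<phi> ` carrier G) G)"

text \<open>
  Since \<open>group.ord\<close> is 0 on elements of infinite order, the following forces every element to have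
  finite order.
\<close>

definition p_group :: "nat \<Rightarrow> ('a, 'b) monoid_scheme \<Rightarrow> bool" where
  "p_group p G \<longleftrightarrow> (\<forall>x \<in> carrier G. \<exists>n. group.ord G x = p ^ n)"

end

theory Submission
  imports Defs
begin

text \<open>
  The implications from co-Hopfian to relatively co-Hopfian to Bassian-finite are immediate. For the
  remaining one, additively, let \<open>f\<close> be an injective endomorphism of \<open>T\<close> that is not onto, and let
  \<open>S\<close> be the socle of \<open>T\<close>.

  If \<open>T\<close> is divisible, then \<open>f(T)\<close> is divisible, hence itself a proper summand. If \<open>T\<close> is not
  divisible and \<open>f(S) \<noteq> S\<close>, then some \<open>y \<in> S\<close> outside \<open>f(T)\<close> has finite height \<open>m\<close>: otherwise add to
  an element of infinite height one of finite height. Writing \<open>y = p^m z\<close>, the cyclic group \<open>\<langle>z\<rangle>\<close> is a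
  summand that meets \<open>f(T)\<close> trivially, so \<open>f\<close> followed by the projection on a complement is injective.

  If \<open>f(S) = S\<close>, then \<open>f\<close> must raise some heights on \<open>S\<close>, so there is an \<open>m\<close> such that \<open>f\<close> maps
  \<open>S \<inter> p^m T\<close> onto itself but not \<open>S \<inter> p^(m+1) T\<close>. Split off a maximal pure direct sum \<open>B\<close> of cyclic
  groups of order \<open>p^(m+1)\<close>, say \<open>T = B \<oplus> C\<close> with \<open>p^(m+1) T \<subseteq> C\<close>. The identity on \<open>B\<close> together with
  \<open>f\<close> followed by the projection on \<open>C\<close> is an injective endomorphism that is not onto on \<open>S\<close>, which
  is the previous case.
\<close>

section \<open>Subgroups and internal direct products\<close>

lemma nat_last_step:
  fixes n :: nat
  assumes "P 0" "\<not> P n"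
  obtains m where "P m" "\<not> P (Suc m)"
  using assms by (induction n) auto

lemma (in group) subgroup_Union_chain:
  assumes "\<C> \<noteq> {}" and chain: "\<And>H K. \<lbrakk>H \<in> \<C>; K \<in> \<C>\<rbrakk> \<Longrightarrow> H \<subseteq> K \<or> K \<subseteq> H"
    and sub: "\<And>M. M \<in> \<C> \<Longrightarrow> subgroup M G"
  shows "subgroup (\<Union>\<C>) G"
proof (rule subgroupI)
  show "\<Union>\<C> \<subseteq> carrier G"
    using sub subgroup.subset by blast
  show "\<Union>\<C> \<noteq> {}"
    using assms(1) sub subgroup.one_closed by blast
  show "inv a \<in> \<Union>\<C>" if "a \<in> \<Union>\<C>" for a
    using that subgroup.m_inv_closed[OF sub] by blast
  show "a \<otimes> b \<in> \<Union>\<C>" if "a \<in> \<Union>\<C>" "b \<in> \<Union>\<C>" for a b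
  proof -
    obtain H K where "a \<in> H" "H \<in> \<C>" "b \<in> K" "K \<in> \<C>"
      using \<open>a \<in> \<Union>\<C>\<close> \<open>b \<in> \<Union>\<C>\<close> by blast
    then obtain Z where "a \<in> Z" "b \<in> Z" "Z \<in> \<C>"
      using chain by blast
    then show ?thesis
      using subgroup.m_closed[OF sub] by blast
  qed
qed

lemma (in group) subgroup_nat_pow_closed:
  assumes "subgroup H G" "x \<in> H"
  shows "x [^] (n::nat) \<in> H"
  using assms by (induction n) (auto simp: subgroup.one_closed subgroup.m_closed)

lemma (in group) subgroup_mult_cancel:
  assumes "subgroup H G" "h \<in> H" "h \<otimes> x \<in> H" "x \<in> carrier G"
  shows "x \<in> H"
proof -
  have "h \<in> carrier G"
    using assms(1,2) by (rule subgroup.mem_carrier)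
  then have "x = inv h \<otimes> (h \<otimes> x)"
    using assms(4) by (simp add: m_assoc [symmetric])
  then show ?thesis
    using assms(1-3) by (metis subgroup.m_closed subgroup.m_inv_closed)
qed

lemma (in group) mem_set_mult_iff: "x \<in> A <#> B \<longleftrightarrow> (\<exists>a\<in>A. \<exists>b\<in>B. x = a \<otimes> b)"
  by (auto simp: set_mult_def)

lemma (in group) subgroup_subset_set_mult:
  assumes "subgroup A G" "subgroup B G"
  shows "A \<subseteq> A <#> B" "B \<subseteq> A <#> B"
proof -
  show "A \<subseteq> A <#> B"
  proof
    fix x assume "x \<in> A"
    then have "x = x \<otimes> \<one>"
      using assms(1) subgroup.mem_carrier by fastforce
    then show "x \<in> A <#> B"
      using \<open>x \<in> A\<close> assms(2) subgroup.one_closed unfolding mem_set_mult_iff by blast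
  qed
  show "B \<subseteq> A <#> B"
  proof
    fix x assume "x \<in> B"
    then have "x = \<one> \<otimes> x"
      using assms(2) subgroup.mem_carrier by fastforce
    then show "x \<in> A <#> B"
      using \<open>x \<in> B\<close> assms(1) subgroup.one_closed unfolding mem_set_mult_iff by blast
  qed
qed

lemma (in comm_group) set_mult_commute:
  assumes "A \<subseteq> carrier G" "B \<subseteq> carrier G"
  shows "A <#> B = B <#> A"
proof -
  have "a \<otimes> b = b \<otimes> a" if "a \<in> A" "b \<in> B" for a b
    using that assms m_comm by blast
  then have "x \<in> A <#> B \<longleftrightarrow> x \<in> B <#> A" for x
    unfolding mem_set_mult_iff by metis
  then show ?thesis
    by blast
qed

lemma (in comm_group) internal_product_unique:
  assumes "subgroup A G" "subgroup B G" "A \<inter> B = {\<one>}"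
    and "a \<in> A" "a' \<in> A" "b \<in> B" "b' \<in> B" "a \<otimes> b = a' \<otimes> b'"
  shows "a = a'" "b = b'"
proof -
  have carr: "a \<in> carrier G" "a' \<in> carrier G" "b \<in> carrier G" "b' \<in> carrier G"
    using assms subgroup.mem_carrier[OF assms(1)] subgroup.mem_carrier[OF assms(2)] by blast+
  have "inv a' \<otimes> a = inv a' \<otimes> (a \<otimes> b) \<otimes> inv b"
    using carr by (simp add: m_assoc)
  also have "\<dots> = b' \<otimes> inv b"
    using carr assms(8) by (simp add: m_assoc [symmetric])
  finally have eq: "inv a' \<otimes> a = b' \<otimes> inv b" .
  have "inv a' \<otimes> a \<in> A" "b' \<otimes> inv b \<in> B"
    using assms by (auto intro: subgroup.m_closed subgroup.m_inv_closed)
  then have "inv a' \<otimes> a = \<one>"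
    using eq assms(3) by auto
  then show "a = a'"
    using carr by (metis inv_equality inv_inv inv_closed)
  then show "b = b'"
    using carr assms(8) by simp
qed

text \<open>The components of each element are picked by choice; uniqueness of the decomposition
  then forces both selections to be homomorphisms.\<close>

lemma (in comm_group) internal_product_projections:
  assumes A: "subgroup A G" and B: "subgroup B G" and AB: "A \<inter> B = {\<one>}" "A <#> B = carrier G"
  obtains \<rho> \<pi> where "\<rho> \<in> hom G G" "\<pi> \<in> hom G G" "\<And>x. x \<in> carrier G \<Longrightarrow> \<rho> x \<in> A"
    "\<And>x. x \<in> carrier G \<Longrightarrow> \<pi> x \<in> B" "\<And>x. x \<in> carrier G \<Longrightarrow> x = \<rho> x \<otimes> \<pi> x"
proof -
  have "\<exists>a b. a \<in> A \<and> b \<in> B \<and> x = a \<otimes> b" if "x \<in> carrier G" for x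
    using that mem_set_mult_iff[of x A B] AB(2) by auto
  then have "\<forall>x. \<exists>a b. x \<in> carrier G \<longrightarrow> a \<in> A \<and> b \<in> B \<and> x = a \<otimes> b"
    by blast
  from choice[OF this] obtain \<rho> where
    "\<forall>x. \<exists>b. x \<in> carrier G \<longrightarrow> \<rho> x \<in> A \<and> b \<in> B \<and> x = \<rho> x \<otimes> b" ..
  from choice[OF this] obtain \<pi> where
    dec: "\<And>x. x \<in> carrier G \<Longrightarrow> \<rho> x \<in> A \<and> \<pi> x \<in> B \<and> x = \<rho> x \<otimes> \<pi> x" by blast
  have carr: "\<rho> x \<in> carrier G" "\<pi> x \<in> carrier G" if "x \<in> carrier G" for x
    using that dec subgroup.mem_carrier[OF A] subgroup.mem_carrier[OF B] by blast+
  have eq: "\<rho> x \<otimes> \<rho> y = \<rho> (x \<otimes> y) \<and> \<pi> x \<otimes> \<pi> y = \<pi> (x \<otimes> y)"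
    if xy: "x \<in> carrier G" "y \<in> carrier G" for x y
  proof -
    have "(\<rho> x \<otimes> \<rho> y) \<otimes> (\<pi> x \<otimes> \<pi> y) = (\<rho> x \<otimes> \<pi> x) \<otimes> (\<rho> y \<otimes> \<pi> y)"
      using xy carr by (simp add: m_ac)
    also have "\<dots> = \<rho> (x \<otimes> y) \<otimes> \<pi> (x \<otimes> y)"
      using dec xy by (metis m_closed)
    finally have *: "(\<rho> x \<otimes> \<rho> y) \<otimes> (\<pi> x \<otimes> \<pi> y) = \<rho> (x \<otimes> y) \<otimes> \<pi> (x \<otimes> y)" .
    have mem: "\<rho> x \<otimes> \<rho> y \<in> A" "\<pi> x \<otimes> \<pi> y \<in> B" "\<rho> (x \<otimes> y) \<in> A" "\<pi> (x \<otimes> y) \<in> B"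
      using dec xy A B by (simp_all add: subgroup.m_closed)
    show ?thesis
      using internal_product_unique[OF A B AB(1) mem(1,3,2,4) *] by blast
  qed
  show ?thesis
    using that[of \<rho> \<pi>] dec carr eq by (auto simp: hom_def)
qed

section \<open>Heights and the socle of an abelian p-group\<close>

locale comm_p_group = comm_group G for G (structure) +
  fixes p :: nat
  assumes prime_p: "Factorial_Ring.prime p"
    and torsion: "x \<in> carrier G \<Longrightarrow> \<exists>n. x [^] (p ^ n) = \<one>"
begin

text \<open>This is \<open>p^n G\<close> in additive notation, so membership says that the height is
  at least \<open>n\<close>.\<close>

definition ppowers :: "nat \<Rightarrow> 'a set" where
  "ppowers n = (\<lambda>x. x [^] (p ^ n)) ` carrier G"

definition socle :: "'a set" where
  "socle = {x \<in> carrier G. x [^] p = \<one>}"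

lemma hom_pow: "\<phi> \<in> hom G G \<Longrightarrow> x \<in> carrier G \<Longrightarrow> \<phi> (x [^] (n::nat)) = \<phi> x [^] n"
  by (rule hom_nat_pow) auto

lemma hom_one': "\<phi> \<in> hom G G \<Longrightarrow> \<phi> \<one> = \<one>"
  by (rule hom_one) auto

lemma subgroup_image: "\<phi> \<in> hom G G \<Longrightarrow> subgroup (\<phi> ` carrier G) G"
  by (rule group_hom.img_is_subgroup) (auto simp: group_hom_def group_hom_axioms_def)

lemma hom_socle: "\<phi> \<in> hom G G \<Longrightarrow> x \<in> socle \<Longrightarrow> \<phi> x \<in> socle"
  unfolding socle_def using hom_in_carrier hom_pow hom_one'
  by (metis (mono_tags, lifting) mem_Collect_eq)

lemma mono_socle_iff:
  assumes "\<phi> \<in> hom G G" "inj_on \<phi> (carrier G)" "x \<in> carrier G"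
  shows "\<phi> x \<in> socle \<longleftrightarrow> x \<in> socle"
proof
  assume "\<phi> x \<in> socle"
  then have "\<phi> (x [^] p) = \<phi> \<one>"
    using assms by (simp add: socle_def hom_pow hom_one')
  then have "x [^] p = \<one>"
    using assms(2,3) by (simp add: inj_on_eq_iff)
  then show "x \<in> socle"
    using assms(3) by (simp add: socle_def)
qed (rule hom_socle[OF assms(1)])

lemma hom_ppowers: "\<phi> \<in> hom G G \<Longrightarrow> x \<in> ppowers n \<Longrightarrow> \<phi> x \<in> ppowers n"
  unfolding ppowers_def using hom_in_carrier hom_pow by fastforce

lemma pow_hom: "(\<lambda>x. x [^] (n::nat)) \<in> hom G G"
  by (auto simp: hom_def nat_pow_distrib)

lemma subgroup_ppowers: "subgroup (ppowers n) G"
  unfolding ppowers_def by (intro subgroup_image pow_hom)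

lemma subgroup_socle: "subgroup socle G"
  unfolding socle_def
  by (rule subgroupI) (auto simp: nat_pow_distrib nat_pow_inv intro: exI[of _ \<one>])

lemma ppowers_0: "ppowers 0 = carrier G"
  unfolding ppowers_def by (auto simp: image_iff)

lemma subgroup_generate: "z \<in> carrier G \<Longrightarrow> subgroup (generate G {z}) G"
  by (rule generate_is_subgroup) auto

text \<open>Natural exponents suffice because \<open>z\<close> has finite order, so its inverse is
  itself one of its natural powers.\<close>

lemma mem_generate_iff:
  assumes "z \<in> carrier G"
  shows "x \<in> generate G {z} \<longleftrightarrow> (\<exists>k::nat. x = z [^] k)"
proof
  obtain n where n: "z [^] (p ^ n) = \<one>"
    using torsion assms by blast
  then have pos: "p ^ n > 0"
    using prime_p prime_gt_0_nat by simp
  have inv: "inv z = z [^] (p ^ n - 1)"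
  proof (rule inv_equality)
    show "z [^] (p ^ n - 1) \<otimes> z = \<one>"
      using n pos by (metis Suc_diff_1 nat_pow_Suc)
  qed (use assms in auto)
  assume "x \<in> generate G {z}"
  then show "\<exists>k::nat. x = z [^] k"
  proof induction
    case one
    show ?case by (rule exI[of _ 0]) simp
  next
    case (incl h)
    then show ?case using assms by (intro exI[of _ 1]) simp
  next
    case (inv h)
    then show ?case using \<open>inv z = _\<close> by blast
  next
    case (eng h1 h2)
    then show ?case using assms nat_pow_mult by metis
  qed
next
  assume "\<exists>k::nat. x = z [^] k"
  then show "x \<in> generate G {z}"
    using subgroup_nat_pow_closed[OF subgroup_generate[OF assms]] generate.incl[of z "{z}" G]
    by blast
qed

lemma mem_adjoin_iff:
  assumes "z \<in> carrier G"
  shows "x \<in> H <#> generate G {z} \<longleftrightarrow> (\<exists>h\<in>H. \<exists>k::nat. x = h \<otimes> z [^] k)"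
  unfolding mem_set_mult_iff mem_generate_iff[OF assms] Bex_def by metis

section \<open>Reductions to p-th powers and to the socle\<close>

text \<open>Some \<open>p ^ n\<close> kills \<open>x\<close>, and \<open>m\<close> is invertible
  modulo \<open>p ^ n\<close>, so by Bezout \<open>x\<close> is a power of
  \<open>x [^] m\<close>.\<close>

lemma subgroup_pow_coprime:
  assumes H: "subgroup H G" and x: "x \<in> carrier G" and "x [^] (m::nat) \<in> H" "\<not> p dvd m"
  shows "x \<in> H"
proof -
  obtain n where n: "x [^] (p ^ n) = \<one>"
    using torsion x by blast
  have "coprime p m"
    using prime_p assms(4) by (rule prime_imp_coprime)
  then have "gcd m (p ^ n) = 1"
    by (simp add: coprime_commute)
  moreover have "m \<noteq> 0"
    using assms(4) by (metis dvd_0_right)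
  ultimately obtain a b where ab: "m * a = p ^ n * b + 1"
    using bezout_nat[of m "p ^ n"] by metis
  have "(x [^] m) [^] a = (x [^] (p ^ n)) [^] b \<otimes> x"
    using x ab by (simp add: nat_pow_pow)
  then have "(x [^] m) [^] a = x"
    using n x by simp
  then show ?thesis
    using subgroup_nat_pow_closed[OF H assms(3)] by metis
qed

lemma pow_boundary:
  assumes "subgroup H G" "x \<in> carrier G" "x \<notin> H"
  obtains e where "x [^] (p ^ e) \<notin> H" "x [^] (p ^ Suc e) \<in> H"
proof -
  obtain n where "x [^] (p ^ n) = \<one>"
    using torsion assms(2) by blast
  then have "x [^] (p ^ n) \<in> H"
    using assms(1) subgroup.one_closed by metis
  moreover have "x [^] (p ^ 0) \<notin> H"
    using assms(2,3) by simp
  ultimately show ?thesis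
    using that nat_last_step[of "\<lambda>n. x [^] (p ^ n) \<notin> H" n] by blast
qed

text \<open>For \<open>x\<close> in \<open>K\<close> outside \<open>H\<close>, the last term outside
  \<open>H\<close> in the sequence of iterated p-th powers of \<open>x\<close> would contradict the
  final assumption.\<close>

lemma subgroup_p_saturated:
  assumes "subgroup H G" "K \<subseteq> carrier G" "subgroup K G"
    and "\<And>u. \<lbrakk>u \<in> K; u [^] p \<in> H\<rbrakk> \<Longrightarrow> u \<in> H"
  shows "K \<subseteq> H"
proof (rule ccontr)
  assume "\<not> K \<subseteq> H"
  then obtain x where x: "x \<in> K" "x \<notin> H" "x \<in> carrier G"
    using assms(2) by blast
  obtain e where "x [^] (p ^ e) \<notin> H" "x [^] (p ^ Suc e) \<in> H"
    using pow_boundary[OF assms(1) x(3,2)] .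
  moreover have "x [^] (p ^ Suc e) = (x [^] (p ^ e)) [^] p"
    using x by (simp add: nat_pow_pow mult.commute)
  ultimately show False
    using assms(4)[of "x [^] (p ^ e)"] subgroup_nat_pow_closed[OF assms(3) x(1)] by auto
qed

lemma subgroup_trivial_if_socle:
  assumes "subgroup H G" "\<And>x. \<lbrakk>x \<in> H; x \<in> socle\<rbrakk> \<Longrightarrow> x = \<one>"
  shows "H = {\<one>}"
proof -
  have "H \<subseteq> {\<one>}"
  proof (rule subgroup_p_saturated)
    show "subgroup {\<one>} G" by (rule triv_subgroup)
    show "H \<subseteq> carrier G" using assms(1) by (rule subgroup.subset)
    show "subgroup H G" by (rule assms(1))
    show "u \<in> {\<one>}" if "u \<in> H" "u [^] p \<in> {\<one>}" for u
    proof -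
      have "u \<in> socle"
        using that subgroup.mem_carrier[OF assms(1) that(1)] by (simp add: socle_def)
      then show ?thesis
        using assms(2) that(1) by blast
    qed
  qed
  then show ?thesis
    using assms(1) subgroup.one_closed by blast
qed

text \<open>The kernel is a subgroup, and a non-trivial subgroup of a p-group contains a non-trivial
  element of the socle.\<close>

lemma inj_on_if_socle:
  assumes f: "f \<in> hom G G" and "\<And>x. \<lbrakk>x \<in> socle; f x = \<one>\<rbrakk> \<Longrightarrow> x = \<one>"
  shows "inj_on f (carrier G)"
proof -
  interpret f: group_hom G G f
    using f by (auto simp: group_hom_def group_hom_axioms_def)
  have "kernel G G f = {\<one>}"
    using assms(2) by (intro subgroup_trivial_if_socle f.subgroup_kernel) (auto simp: kernel_def)
  then show ?thesis
    by (simp add: f.inj_iff_trivial_ker)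
qed

section \<open>Complements by Zorn's lemma\<close>

text \<open>\<open>C\<close> is maximal among the subgroups that contain \<open>D\<close> and meet
  \<open>A\<close> trivially. The assumption \<open>div\<close> covers both uses: \<open>A\<close>
  divisible, and \<open>A\<close> homogeneous with \<open>D\<close> a suitable
  \<open>ppowers\<close>.\<close>

lemma complement_exists:
  assumes A: "subgroup A G" and D: "subgroup D G" "D \<inter> A = {\<one>}"
    and div: "\<And>C u c a. \<lbrakk>subgroup C G; D \<subseteq> C; C \<inter> A = {\<one>}; u \<in> carrier G; c \<in> C; a \<in> A;
      u [^] p = c \<otimes> a\<rbrakk> \<Longrightarrow> \<exists>a'\<in>A. a = a' [^] p"
  obtains C where "subgroup C G" "D \<subseteq> C" "C \<inter> A = {\<one>}" "C <#> A = carrier G"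
proof -
  let ?F = "{C. subgroup C G \<and> D \<subseteq> C \<and> C \<inter> A = {\<one>}}"
  have "\<exists>M\<in>?F. \<forall>N\<in>?F. M \<subseteq> N \<longrightarrow> N = M"
  proof (rule subset_Zorn_nonempty)
    show "?F \<noteq> {}" using D by blast
    fix \<C> assume C: "\<C> \<noteq> {}" "subset.chain ?F \<C>"
    have "subgroup (\<Union>\<C>) G"
      using C by (intro subgroup_Union_chain) (auto simp: subset_chain_def)
    moreover have "D \<subseteq> \<Union>\<C>" "\<Union>\<C> \<inter> A = {\<one>}"
      using C by (fastforce simp: subset_chain_def)+
    ultimately show "\<Union>\<C> \<in> ?F" by blast
  qed
  then obtain C where "C \<in> ?F" and C_max: "\<forall>N\<in>?F. C \<subseteq> N \<longrightarrow> N = C" ..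
  then have C: "subgroup C G" "D \<subseteq> C" "C \<inter> A = {\<one>}"
    by auto
  have max: "N = C" if "subgroup N G" "D \<subseteq> N" "N \<inter> A = {\<one>}" "C \<subseteq> N" for N
    using C_max that by simp
  have CA: "subgroup (C <#> A) G"
    using C(1) A by (rule mult_subgroups)
  have "carrier G \<subseteq> C <#> A"
  proof (rule subgroup_p_saturated[OF CA])
    fix u assume u: "u \<in> carrier G" "u [^] p \<in> C <#> A"
    then obtain c a where ca: "c \<in> C" "a \<in> A" "u [^] p = c \<otimes> a"
      using mem_set_mult_iff by blast
    obtain a' where a': "a' \<in> A" "a = a' [^] p"
      using div[OF C u(1) ca] by blast
    \<comment> \<open>Correcting \<open>u\<close> by a p-th root of \<open>a\<close> moves its p-th
      power into \<open>C\<close> without changing its class modulo \<open>A\<close>.\<close>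
    define v where "v = u \<otimes> inv a'"
    have carr: "c \<in> carrier G" "a' \<in> carrier G" "v \<in> carrier G"
      using ca a'(1) u subgroup.mem_carrier[OF A] subgroup.mem_carrier[OF C(1)]
      unfolding v_def by auto
    have vp: "v [^] p = c"
      unfolding v_def using u carr ca(3) a'(2) by (simp add: nat_pow_distrib nat_pow_inv m_assoc)
    have uv: "u = v \<otimes> a'"
      unfolding v_def using u carr by (simp add: m_assoc)
    let ?M = "C <#> generate G {v}"
    have M: "subgroup ?M G"
      by (intro mult_subgroups C subgroup_generate carr)
    \<comment> \<open>If not, \<open>v [^] k\<close> lies in \<open>C <#> A\<close> only when
      \<open>p\<close> divides \<open>k\<close>, and then it is a power of \<open>c\<close>. So
      \<open>?M\<close> still meets \<open>A\<close> trivially, and maximality puts \<open>v\<close>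
      in \<open>C\<close> after all.\<close>
    have "v \<in> C <#> A"
    proof (rule ccontr)
      assume v: "v \<notin> C <#> A"
      have "x = \<one>" if x: "x \<in> ?M" "x \<in> A" for x
      proof -
        obtain c' k where c': "c' \<in> C" "x = c' \<otimes> v [^] (k::nat)"
          using x(1) mem_adjoin_iff[OF carr(3)] by blast
        have "v [^] k \<in> C <#> A"
          using subgroup_mult_cancel[OF CA, of c' "v [^] k"] c' x(2) carr
            subgroup_subset_set_mult[OF C(1) A] by auto
        then have "p dvd k"
          using v subgroup_pow_coprime[OF CA carr(3)] by blast
        then obtain j where "k = p * j" ..
        then have "v [^] k = c [^] j"
          using carr vp by (simp add: nat_pow_pow [symmetric])
        then have "x \<in> C"
          using c' ca(1) C(1) by (simp add: subgroup.m_closed subgroup_nat_pow_closed)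
        then show ?thesis using x(2) C(3) by blast
      qed
      then have "?M \<inter> A = {\<one>}"
        using M A subgroup.one_closed by blast
      moreover have "C \<subseteq> ?M" "generate G {v} \<subseteq> ?M"
        using subgroup_subset_set_mult[OF C(1) subgroup_generate[OF carr(3)]] by auto
      ultimately have "v \<in> C"
        using max[OF M] C(2) generate.incl[of v "{v}" G] by blast
      then show False
        using v subgroup_subset_set_mult[OF C(1) A] by blast
    qed
    then show "u \<in> C <#> A"
      using uv a'(1) subgroup_subset_set_mult[OF C(1) A] subgroup.m_closed[OF CA] by blast
  qed (simp_all add: subgroup_self)
  then have "C <#> A = carrier G"
    using subgroup.subset[OF CA] by blast
  then show ?thesis
    using that C by blast
qed

section \<open>Homogeneous pure subgroups\<close>

text \<open>
  These are the pure subgroups that are direct sums of cyclic groups of order \<open>p^(m + 1)\<close>, stated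
  so that the property passes to unions of chains.
\<close>

definition homogeneous :: "nat \<Rightarrow> 'a set \<Rightarrow> bool" where
  "homogeneous m B \<longleftrightarrow> subgroup B G \<and> B \<inter> ppowers (Suc m) = {\<one>} \<and>
     (\<forall>b\<in>B. b [^] (p ^ m) = \<one> \<longrightarrow> (\<exists>b'\<in>B. b = b' [^] p))"

lemma homogeneous_trivial: "homogeneous m {\<one>}"
  unfolding homogeneous_def
  using subgroup.one_closed[OF subgroup_ppowers] by (auto simp: triv_subgroup)

text \<open>Roots are extracted inside \<open>B\<close> one at a time: a root of \<open>b\<close> of
  level \<open>j < m\<close> is killed by \<open>p ^ Suc j\<close>, hence by \<open>p ^ m\<close>,
  so it is again a p-th power in \<open>B\<close>.\<close>

lemma homogeneous_socle:
  assumes B: "homogeneous m B" and b: "b \<in> B" "b \<in> socle"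
  shows "b \<in> ppowers m"
proof -
  have sub: "subgroup B G"
    using B by (simp add: homogeneous_def)
  have "j \<le> m \<Longrightarrow> \<exists>b'\<in>B. b = b' [^] (p ^ j)" for j
  proof (induction j)
    case 0
    have "b [^] (p ^ 0) = b"
      using subgroup.mem_carrier[OF sub b(1)] by simp
    then show ?case using b(1) by metis
  next
    case (Suc j)
    then obtain b' where b': "b' \<in> B" "b = b' [^] (p ^ j)" by auto
    have carr: "b' \<in> carrier G"
      using b'(1) sub by (rule subgroup.mem_carrier[rotated])
    have "b' [^] (p ^ Suc j) = \<one>"
      using b(2) b'(2) carr by (simp add: socle_def nat_pow_pow mult.commute)
    moreover have "p ^ m = p ^ Suc j * p ^ (m - Suc j)"
      using Suc.prems by (metis power_add le_add_diff_inverse)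
    ultimately have "b' [^] (p ^ m) = \<one>"
      using carr by (metis nat_pow_pow nat_pow_one)
    then obtain b'' where b'': "b'' \<in> B" "b' = b'' [^] p"
      using B b'(1) unfolding homogeneous_def by blast
    then have "b = b'' [^] (p ^ Suc j)"
      using b'(2) subgroup.mem_carrier[OF sub b''(1)] by (simp add: nat_pow_pow)
    then show ?case using b''(1) by blast
  qed
  from this[of m] show ?thesis
    using subgroup.mem_carrier[OF sub] unfolding ppowers_def by auto
qed

text \<open>Raising \<open>u [^] p = c \<otimes> a\<close> to the power \<open>p ^ m\<close> puts
  the left side in \<open>ppowers (Suc m)\<close>, hence in \<open>C\<close>. So
  \<open>a [^] (p ^ m)\<close> lies in both \<open>C\<close> and \<open>B\<close> and is trivial,
  which makes \<open>a\<close> a p-th power in \<open>B\<close>.\<close>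

lemma homogeneous_complement:
  assumes B: "homogeneous m B"
  obtains C where "subgroup C G" "ppowers (Suc m) \<subseteq> C" "C \<inter> B = {\<one>}" "C <#> B = carrier G"
proof -
  have sub: "subgroup B G" and triv: "ppowers (Suc m) \<inter> B = {\<one>}"
    using B by (auto simp: homogeneous_def)
  have div: "\<exists>a'\<in>B. a = a' [^] p"
    if C: "subgroup C G" "ppowers (Suc m) \<subseteq> C" "C \<inter> B = {\<one>}"
      and u: "u \<in> carrier G" "c \<in> C" "a \<in> B" "u [^] p = c \<otimes> a" for C u c a
  proof -
    have carr: "c \<in> carrier G" "a \<in> carrier G"
      using u subgroup.mem_carrier[OF C(1)] subgroup.mem_carrier[OF sub] by blast+
    have "u [^] (p ^ Suc m) = c [^] (p ^ m) \<otimes> a [^] (p ^ m)"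
      using u carr by (simp add: nat_pow_pow [symmetric] nat_pow_distrib)
    moreover have "u [^] (p ^ Suc m) \<in> C"
      using u C unfolding ppowers_def by blast
    ultimately have "a [^] (p ^ m) \<in> C"
      using carr C(1) u(2) by (metis nat_pow_closed subgroup_mult_cancel subgroup_nat_pow_closed)
    moreover have "a [^] (p ^ m) \<in> B"
      using subgroup_nat_pow_closed[OF sub u(3)] .
    ultimately have "a [^] (p ^ m) = \<one>"
      using C(3) by blast
    then show ?thesis
      using B u(3) unfolding homogeneous_def by blast
  qed
  show ?thesis
    using div that by (rule complement_exists[OF sub subgroup_ppowers triv])
qed

text \<open>This is the enlargement step for maximality, and with trivial \<open>B\<close> it also
  yields cyclic summands. The assumption \<open>nmem\<close> makes the socle element of the new
  cyclic factor independent of \<open>B\<close> modulo \<open>ppowers (Suc m)\<close>.\<close>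

lemma homogeneous_adjoin:
  assumes B: "homogeneous m B" and z: "z \<in> carrier G" "z [^] (p ^ Suc m) = \<one>"
    and nmem: "z [^] (p ^ m) \<notin> B <#> ppowers (Suc m)"
  shows "homogeneous m (B <#> generate G {z})"
proof -
  let ?y = "z [^] (p ^ m)" and ?M = "B <#> generate G {z}"
  have sub: "subgroup B G"
    using B by (simp add: homogeneous_def)
  have S: "subgroup (B <#> ppowers (Suc m)) G"
    by (intro mult_subgroups sub subgroup_ppowers)
  have y: "?y \<in> carrier G" "?y [^] p = \<one>"
    using z by (auto simp: nat_pow_pow mult.commute)
  have M: "subgroup ?M G"
    by (intro mult_subgroups sub subgroup_generate z)
  have "x = \<one>" if x: "x \<in> ?M" "x \<in> ppowers (Suc m)" "x \<in> socle" for x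
  proof -
    obtain b k where bk: "b \<in> B" "x = b \<otimes> z [^] (k::nat)"
      using x(1) mem_adjoin_iff[OF z(1)] by blast
    have b: "b \<in> carrier G"
      using sub bk(1) by (rule subgroup.mem_carrier)
    have inS: "z [^] k \<in> B <#> ppowers (Suc m)"
      using subgroup_mult_cancel[OF S, of b "z [^] k"] bk x(2) z(1)
        subgroup_subset_set_mult[OF sub subgroup_ppowers] by blast
    have "p ^ Suc m dvd k"
    proof (rule ccontr)
      assume ndvd: "\<not> p ^ Suc m dvd k"
      then have "k \<noteq> 0" by (metis dvd_0_right)
      \<comment> \<open>With \<open>p ^ e\<close> the exact power of \<open>p\<close> in
        \<open>k\<close> and \<open>e \<le> m\<close>, raising \<open>z [^] k\<close> to the power
        \<open>p ^ (m - e)\<close> gives a power of \<open>?y\<close> with exponent prime to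
        \<open>p\<close>, which forces \<open>?y\<close> itself into the forbidden product.\<close>
      define e where "e = multiplicity p k"
      obtain k' where k': "k = p ^ e * k'" "\<not> p dvd k'"
        using multiplicity_decompose'[of k p] \<open>k \<noteq> 0\<close> prime_p unfolding e_def
        by (metis not_prime_unit)
      have "e \<le> m"
        using ndvd k'(1) by (metis dvd_triv_left le_imp_power_dvd dvd_trans not_less_eq_eq)
      then have "p ^ m = p ^ e * p ^ (m - e)"
        by (simp add: power_add [symmetric])
      then have "k * p ^ (m - e) = p ^ m * k'"
        using k'(1) by simp
      then have "(z [^] k) [^] (p ^ (m - e)) = ?y [^] k'"
        using z(1) by (simp add: nat_pow_pow)
      then have "?y [^] k' \<in> B <#> ppowers (Suc m)"
        using subgroup_nat_pow_closed[OF S inS] by metis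
      then show False
        using subgroup_pow_coprime[OF S y(1) _ k'(2)] nmem by blast
    qed
    then obtain j where "k = p ^ Suc m * j" ..
    then have "z [^] k = \<one>"
      using z by (metis nat_pow_pow nat_pow_one)
    then have "x \<in> B"
      using bk b by simp
    then show ?thesis
      using x(2) B unfolding homogeneous_def by blast
  qed
  then have "?M \<inter> ppowers (Suc m) = {\<one>}"
    by (intro subgroup_trivial_if_socle subgroups_Inter_pair M subgroup_ppowers) auto
  moreover have "\<exists>x'\<in>?M. x = x' [^] p" if x: "x \<in> ?M" "x [^] (p ^ m) = \<one>" for x
  proof -
    obtain b k where bk: "b \<in> B" "x = b \<otimes> z [^] (k::nat)"
      using x(1) mem_adjoin_iff[OF z(1)] by blast
    have b: "b \<in> carrier G"
      using sub bk(1) by (rule subgroup.mem_carrier)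
    \<comment> \<open>Since \<open>?y\<close> is not in \<open>B\<close>, this relation forces
      \<open>p\<close> to divide \<open>k\<close>. Both factors are then trivial, and each component
      of \<open>x\<close> has a p-th root.\<close>
    have eq: "b [^] (p ^ m) \<otimes> ?y [^] k = \<one>"
      using x(2) bk(2) b z(1) by (simp add: nat_pow_distrib nat_pow_pow mult.commute)
    then have "?y [^] k \<in> B"
      using subgroup_mult_cancel[OF sub, of "b [^] (p ^ m)" "?y [^] k"] y(1)
        subgroup_nat_pow_closed[OF sub bk(1)] subgroup.one_closed[OF sub] by auto
    moreover have "?y \<notin> B"
      using nmem subgroup_subset_set_mult[OF sub subgroup_ppowers] by blast
    ultimately have "p dvd k"
      using subgroup_pow_coprime[OF sub y(1)] by blast
    then obtain j where j: "k = p * j" ..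
    then have "?y [^] k = \<one>"
      using y by (metis nat_pow_pow nat_pow_one)
    then have "b [^] (p ^ m) = \<one>"
      using eq b by simp
    then obtain b' where b': "b' \<in> B" "b = b' [^] p"
      using B bk(1) unfolding homogeneous_def by blast
    have "x = (b' \<otimes> z [^] j) [^] p"
      using bk(2) b'(2) j z(1) subgroup.mem_carrier[OF sub b'(1)]
      by (simp add: nat_pow_distrib nat_pow_pow mult.commute)
    then show ?thesis
      using b'(1) mem_adjoin_iff[OF z(1)] by blast
  qed
  ultimately show ?thesis
    using M unfolding homogeneous_def by blast
qed

text \<open>For a maximal \<open>B\<close>, an element \<open>z [^] (p ^ m)\<close> of the socle
  outside the product would allow \<open>z\<close> to be adjoined.\<close>

lemma maximal_homogeneous:
  obtains B where "homogeneous m B" "socle \<inter> ppowers m \<subseteq> B <#> ppowers (Suc m)"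
proof -
  have "\<exists>M\<in>Collect (homogeneous m). \<forall>N\<in>Collect (homogeneous m). M \<subseteq> N \<longrightarrow> N = M"
  proof (rule subset_Zorn_nonempty)
    show "Collect (homogeneous m) \<noteq> {}" using homogeneous_trivial by blast
    fix \<C> assume C: "\<C> \<noteq> {}" "subset.chain (Collect (homogeneous m)) \<C>"
    then have hom: "\<And>M. M \<in> \<C> \<Longrightarrow> homogeneous m M"
      by (auto simp: subset_chain_def)
    have "subgroup (\<Union>\<C>) G"
      using C by (intro subgroup_Union_chain) (auto simp: subset_chain_def homogeneous_def)
    moreover have "\<Union>\<C> \<inter> ppowers (Suc m) = {\<one>}"
      using C(1) hom unfolding homogeneous_def by fastforce
    moreover have "\<forall>b\<in>\<Union>\<C>. b [^] (p ^ m) = \<one> \<longrightarrow> (\<exists>b'\<in>\<Union>\<C>. b = b' [^] p)"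
      using hom unfolding homogeneous_def by blast
    ultimately show "\<Union>\<C> \<in> Collect (homogeneous m)"
      unfolding homogeneous_def by blast
  qed
  then obtain B where B: "homogeneous m B"
    and max: "\<And>M. \<lbrakk>homogeneous m M; B \<subseteq> M\<rbrakk> \<Longrightarrow> M = B"
    by blast
  have sub: "subgroup B G"
    using B by (simp add: homogeneous_def)
  have "s \<in> B <#> ppowers (Suc m)" if s: "s \<in> socle" "s \<in> ppowers m" for s
  proof (rule ccontr)
    assume nmem: "s \<notin> B <#> ppowers (Suc m)"
    obtain z where z: "z \<in> carrier G" "s = z [^] (p ^ m)"
      using s(2) by (auto simp: ppowers_def)
    have "z [^] (p ^ Suc m) = \<one>"
      using s(1) z by (simp add: socle_def nat_pow_pow mult.commute)
    then have "B <#> generate G {z} = B"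
      using max homogeneous_adjoin[OF B z(1)] nmem z(2)
        subgroup_subset_set_mult[OF sub subgroup_generate[OF z(1)]] by blast
    then have "z \<in> B"
      using subgroup_subset_set_mult[OF sub subgroup_generate[OF z(1)]] generate.incl[of z "{z}" G]
      by blast
    then have "s \<in> B"
      using z(2) subgroup_nat_pow_closed[OF sub] by blast
    then show False
      using nmem subgroup_subset_set_mult[OF sub subgroup_ppowers] by blast
  qed
  then show ?thesis
    using that B by blast
qed

section \<open>Injective endomorphisms that refute Bassian-finiteness\<close>

text \<open>Induction on the exponent of \<open>x\<close>: if \<open>x [^] (p ^ n)\<close> is in the
  socle, it equals \<open>u [^] (p ^ Suc n)\<close> for some \<open>u\<close>, and dividing
  \<open>x\<close> by \<open>u [^] p\<close> lowers the exponent.\<close>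

lemma divisible_if_socle_divisible:
  assumes "\<And>n. socle \<subseteq> ppowers n"
  shows "carrier G = ppowers 1"
proof -
  have "x [^] (p ^ n) = \<one> \<Longrightarrow> x \<in> carrier G \<Longrightarrow> x \<in> ppowers 1" for x n
  proof (induction n arbitrary: x)
    case 0
    then show ?case using subgroup.one_closed[OF subgroup_ppowers] by simp
  next
    case (Suc n)
    then have "x [^] (p ^ n) \<in> socle"
      by (simp add: socle_def nat_pow_pow mult.commute)
    then obtain u where u: "u \<in> carrier G" "x [^] (p ^ n) = u [^] (p ^ Suc n)"
      using assms[of "Suc n"] unfolding ppowers_def by blast
    have "(x \<otimes> inv (u [^] p)) [^] (p ^ n) = x [^] (p ^ n) \<otimes> inv (u [^] (p ^ Suc n))"
      using u(1) Suc.prems by (simp add: nat_pow_distrib nat_pow_inv nat_pow_pow)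
    also have "\<dots> = \<one>"
      using u by (simp del: power_Suc)
    finally have "x \<otimes> inv (u [^] p) \<in> ppowers 1"
      using Suc.IH u(1) Suc.prems(2) by simp
    moreover have "u [^] p \<in> ppowers 1"
      using u(1) by (auto simp: ppowers_def)
    moreover have "x = x \<otimes> inv (u [^] p) \<otimes> u [^] p"
      using u(1) Suc.prems(2) by (simp add: m_assoc)
    ultimately show ?case
      using subgroup.m_closed[OF subgroup_ppowers] by metis
  qed
  then show ?thesis
    using torsion subgroup.subset[OF subgroup_ppowers] by blast
qed

lemma not_bassian_finiteI:
  assumes "subgroup A G" "subgroup C G" "C \<inter> A = {\<one>}" "C <#> A = carrier G" "C \<noteq> carrier G"
    and "f \<in> hom G G" "inj_on f (carrier G)" "f ` carrier G \<subseteq> C"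
  shows "\<not> bassian_finite G"
proof -
  have "direct_summand C G"
    using assms unfolding direct_summand_def by blast
  moreover have "f \<in> mon G (G\<lparr>carrier := C\<rparr>)"
    using assms by (auto simp: mon_def hom_def)
  ultimately show ?thesis
    using assms(5) unfolding bassian_finite_def by blast
qed

lemma not_bassian_finite_divisible:
  assumes div: "carrier G = ppowers 1"
    and f: "f \<in> hom G G" "inj_on f (carrier G)" "f ` carrier G \<noteq> carrier G"
  shows "\<not> bassian_finite G"
proof -
  have sub: "subgroup (f ` carrier G) G"
    using f(1) by (rule subgroup_image)
  have "\<exists>a'\<in>f ` carrier G. a = a' [^] p" if a: "a \<in> f ` carrier G" for a
  proof -
    obtain u where "u \<in> ppowers 1" "a = f u"
      using a div by blast
    then obtain x where "x \<in> carrier G" "a = f (x [^] p)"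
      by (auto simp: ppowers_def)
    then show ?thesis
      using hom_pow[OF f(1)] by blast
  qed
  moreover have "{\<one>} \<inter> f ` carrier G = {\<one>}"
    using subgroup.one_closed[OF sub] by blast
  ultimately obtain C
    where "subgroup C G" "C \<inter> f ` carrier G = {\<one>}" "C <#> f ` carrier G = carrier G"
    using complement_exists[OF sub triv_subgroup] by metis
  moreover from this have "f ` carrier G <#> C = carrier G"
    using set_mult_commute sub subgroup.subset by metis
  ultimately show ?thesis
    using not_bassian_finiteI[of C "f ` carrier G" f] f sub by blast
qed

lemma not_bassian_finite_socle:
  assumes f: "f \<in> hom G G" "inj_on f (carrier G)"
    and y: "y \<in> socle" "y \<notin> f ` carrier G" "y \<notin> ppowers n"
  shows "\<not> bassian_finite G"
proof -
  have "y \<in> ppowers 0"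
    using y(1) by (simp add: ppowers_0 socle_def)
  \<comment> \<open>\<open>m\<close> is the exact height of \<open>y\<close>.\<close>
  then obtain m where m: "y \<in> ppowers m" "y \<notin> ppowers (Suc m)"
    using y(3) nat_last_step[of "\<lambda>n. y \<in> ppowers n" n] by blast
  then obtain z where z: "z \<in> carrier G" "y = z [^] (p ^ m)"
    by (auto simp: ppowers_def)
  have zp: "z [^] (p ^ Suc m) = \<one>"
    using y(1) z by (simp add: socle_def nat_pow_pow mult.commute)
  \<comment> \<open>This is just the cyclic group of \<open>z\<close>; the trivial factor lets
    \<open>homogeneous_adjoin\<close> apply.\<close>
  define A where "A = {\<one>} <#> generate G {z}"
  have "{\<one>} <#> ppowers (Suc m) = ppowers (Suc m)"
    using subgroup.mem_carrier[OF subgroup_ppowers] by (auto simp: set_mult_def)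
  then have A: "homogeneous m A"
    unfolding A_def using homogeneous_adjoin[OF homogeneous_trivial z(1) zp] m(2) z(2) by simp
  then have sub: "subgroup A G"
    by (simp add: homogeneous_def)
  have "y \<in> A"
    unfolding A_def mem_adjoin_iff[OF z(1)] using z by auto
  obtain C where C: "subgroup C G" "C \<inter> A = {\<one>}" "C <#> A = carrier G"
    using homogeneous_complement[OF A] by metis
  have "y \<noteq> \<one>"
    using m(2) subgroup.one_closed[OF subgroup_ppowers] by blast
  have triv: "f ` carrier G \<inter> A = {\<one>}"
  proof (rule subgroup_trivial_if_socle)
    show "subgroup (f ` carrier G \<inter> A) G"
      using subgroup_image[OF f(1)] sub by (rule subgroups_Inter_pair)
    fix x assume x: "x \<in> f ` carrier G \<inter> A" "x \<in> socle"
    obtain k where k: "x = z [^] (k::nat)"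
      using x(1) z(1) unfolding A_def Int_iff mem_adjoin_iff[OF z(1)] by auto
    \<comment> \<open>The exact order of \<open>z\<close> shows that the socle of \<open>A\<close>
      consists of powers of \<open>y\<close>. An exponent prime to \<open>p\<close> would put
      \<open>y\<close> in the image of \<open>f\<close>.\<close>
    have "ord z dvd p ^ Suc m" "\<not> ord z dvd p ^ m"
      using zp z \<open>y \<noteq> \<one>\<close> pow_eq_id[OF z(1)] by auto
    then have "ord z = p ^ Suc m"
      using prime_p by (metis divides_primepow_nat le_Suc_eq le_imp_power_dvd)
    moreover have "ord z dvd k * p"
      using x(2) k z(1) pow_eq_id[OF z(1)] by (simp add: socle_def nat_pow_pow)
    ultimately have "p ^ m dvd k"
      using prime_p prime_gt_0_nat[OF prime_p] by (simp add: mult.commute)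
    then obtain j where j: "k = p ^ m * j" ..
    have xy: "x = y [^] j"
      using j k z by (simp add: nat_pow_pow)
    then have "p dvd j"
      using subgroup_pow_coprime[OF subgroup_image[OF f(1)], of y j] x(1) y by (auto simp: socle_def)
    then obtain i where "j = p * i" ..
    then show "x = \<one>"
      using xy y(1) nat_pow_pow[of y p i] by (simp add: socle_def)
  qed
  obtain \<pi> \<rho> where pr: "\<pi> \<in> hom G G" "\<And>x. x \<in> carrier G \<Longrightarrow> \<pi> x \<in> C"
    "\<And>x. x \<in> carrier G \<Longrightarrow> \<rho> x \<in> A" "\<And>x. x \<in> carrier G \<Longrightarrow> x = \<pi> x \<otimes> \<rho> x"
    using internal_product_projections[OF C(1) sub C(2,3)] by metis
  show ?thesis
  proof (rule not_bassian_finiteI[OF sub C])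
    show "C \<noteq> carrier G"
      using \<open>y \<in> A\<close> \<open>y \<noteq> \<one>\<close> C(2) subgroup.mem_carrier[OF sub] by blast
    show comp: "\<pi> \<circ> f \<in> hom G G"
      unfolding hom_def using hom_in_carrier[OF f(1)] hom_in_carrier[OF pr(1)]
      by (auto simp: hom_mult[OF f(1)] hom_mult[OF pr(1)])
    show "(\<pi> \<circ> f) ` carrier G \<subseteq> C"
      using pr(2) hom_in_carrier[OF f(1)] by auto
    show "inj_on (\<pi> \<circ> f) (carrier G)"
    proof (rule inj_on_if_socle[OF comp])
      fix x assume x: "x \<in> socle" "(\<pi> \<circ> f) x = \<one>"
      then have xc: "x \<in> carrier G" "f x \<in> carrier G"
        using hom_in_carrier[OF f(1)] by (auto simp: socle_def)
      then have "f x \<in> A"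
        using pr(3,4)[of "f x"] x(2) subgroup.mem_carrier[OF sub] by simp
      then have "f x = f \<one>"
        using triv xc hom_one'[OF f(1)] by auto
      then show "x = \<one>"
        using f(2) xc(1) by (meson inj_onD one_closed)
    qed
  qed
qed

text \<open>Induction on the exponent of \<open>x\<close>: the element \<open>x [^] (p ^ n)\<close>
  of the socle has a preimage of the form \<open>w [^] (p ^ n)\<close>, so
  \<open>x \<otimes> inv (f w)\<close> is killed by \<open>p ^ n\<close>. The height bound on the
  preimage is what provides \<open>w\<close>.\<close>

lemma surj_if_heights_preserved:
  assumes f: "f \<in> hom G G"
    and socle: "\<And>n. socle \<inter> ppowers n \<subseteq> f ` (socle \<inter> ppowers n)"
  shows "f ` carrier G = carrier G"
proof -
  let ?I = "f ` carrier G"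
  have I: "subgroup ?I G"
    using f by (rule subgroup_image)
  have "x [^] (p ^ n) = \<one> \<Longrightarrow> x \<in> carrier G \<Longrightarrow> x \<in> ?I" for x n
  proof (induction n arbitrary: x)
    case 0
    then show ?case using subgroup.one_closed[OF I] by simp
  next
    case (Suc n)
    then have "x [^] (p ^ n) \<in> socle \<inter> ppowers n"
      by (auto simp: socle_def ppowers_def nat_pow_pow mult.commute)
    then obtain u where "u \<in> ppowers n" "x [^] (p ^ n) = f u"
      using socle[of n] by blast
    then obtain w where w: "w \<in> carrier G" "x [^] (p ^ n) = f w [^] (p ^ n)"
      using hom_pow[OF f] unfolding ppowers_def by auto
    have fw: "f w \<in> carrier G"
      using w(1) hom_in_carrier[OF f] by blast
    have "(x \<otimes> inv (f w)) [^] (p ^ n) = \<one>"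
      using w fw Suc.prems(2) by (simp add: nat_pow_distrib nat_pow_inv)
    then have "x \<otimes> inv (f w) \<in> ?I"
      using Suc.IH fw Suc.prems(2) by simp
    moreover have "x = x \<otimes> inv (f w) \<otimes> f w"
      using fw Suc.prems(2) by (simp add: m_assoc)
    ultimately show ?case
      using subgroup.m_closed[OF I] w(1) by (metis imageI)
  qed
  then show ?thesis
    using torsion subgroup.subset[OF I] by blast
qed

lemma not_bassian_finite_not_surj_socle:
  assumes f: "f \<in> hom G G" "inj_on f (carrier G)"
    and v: "v \<in> socle" "v \<notin> f ` carrier G"
  shows "\<not> bassian_finite G"
proof (cases "\<exists>x n. x \<in> socle \<and> x \<notin> ppowers n")
  case True
  then obtain x n where x: "x \<in> socle" "x \<notin> ppowers n" by blast
  have I: "subgroup (f ` carrier G) G"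
    using f(1) by (rule subgroup_image)
  have carr: "x \<in> carrier G" "v \<in> carrier G"
    using x v by (auto simp: socle_def)
  have xv: "x \<otimes> v \<in> socle"
    using x(1) v(1) by (rule subgroup.m_closed[OF subgroup_socle])
  \<comment> \<open>An element of the socle outside both subgroups is wanted. In the last case each
    of \<open>x\<close> and \<open>v\<close> lies in exactly one of them, so their product lies in
    neither.\<close>
  consider "v \<notin> ppowers n" | "x \<notin> f ` carrier G"
    | "v \<in> ppowers n" "x \<in> f ` carrier G" by blast
  then show ?thesis
  proof cases
    case 3
    have "x \<otimes> v \<notin> f ` carrier G"
      using 3(2) v(2) subgroup_mult_cancel[OF I _ _ carr(2)] by blast
    moreover have "x \<otimes> v \<notin> ppowers n"
      using 3(1) x(2) subgroup_mult_cancel[OF subgroup_ppowers 3(1) _ carr(1)] m_comm carr by auto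
    ultimately show ?thesis
      using not_bassian_finite_socle[OF f xv] by blast
  next
    case 1
    show ?thesis
      by (rule not_bassian_finite_socle[OF f v 1])
  next
    case 2
    show ?thesis
      by (rule not_bassian_finite_socle[OF f x(1) 2 x(2)])
  qed
next
  case False
  have "f ` carrier G \<noteq> carrier G"
    using v by (auto simp: socle_def)
  then show ?thesis
    using False by (intro not_bassian_finite_divisible[OF _ f] divisible_if_socle_divisible) auto
qed

lemma not_bassian_finite_heights_raised:
  assumes f: "f \<in> hom G G" "inj_on f (carrier G)"
    and onto: "socle \<inter> ppowers m \<subseteq> f ` (socle \<inter> ppowers m)"
    and u: "u \<in> socle \<inter> ppowers (Suc m)" "u \<notin> f ` (socle \<inter> ppowers (Suc m))"
  shows "\<not> bassian_finite G"
proof -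
  obtain B where B: "homogeneous m B" "socle \<inter> ppowers m \<subseteq> B <#> ppowers (Suc m)"
    using maximal_homogeneous .
  obtain C where C: "subgroup C G" "ppowers (Suc m) \<subseteq> C" "C \<inter> B = {\<one>}" "C <#> B = carrier G"
    using homogeneous_complement[OF B(1)] .
  have sub: "subgroup B G"
    using B(1) by (simp add: homogeneous_def)
  obtain \<pi> \<rho> where pr: "\<pi> \<in> hom G G" "\<rho> \<in> hom G G" "\<And>x. x \<in> carrier G \<Longrightarrow> \<pi> x \<in> C"
    "\<And>x. x \<in> carrier G \<Longrightarrow> \<rho> x \<in> B" "\<And>x. x \<in> carrier G \<Longrightarrow> x = \<pi> x \<otimes> \<rho> x"
    using internal_product_projections[OF C(1) sub C(3,4)] by metis
  have closed: "\<pi> x \<in> carrier G" "\<rho> x \<in> carrier G" "f x \<in> carrier G" if "x \<in> carrier G" for x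
    using that hom_in_carrier[OF pr(1)] hom_in_carrier[OF pr(2)] hom_in_carrier[OF f(1)] by auto
  have sc: "x \<in> socle \<Longrightarrow> x \<in> carrier G" for x
    by (simp add: socle_def)
  have ppSuc: "ppowers (Suc m) \<subseteq> ppowers m"
  proof
    fix y assume "y \<in> ppowers (Suc m)"
    then obtain x where x: "x \<in> carrier G" "y = x [^] (p ^ Suc m)"
      by (auto simp: ppowers_def)
    then have "y = (x [^] p) [^] (p ^ m)"
      by (simp add: nat_pow_pow)
    then show "y \<in> ppowers m"
      using x(1) unfolding ppowers_def by blast
  qed
  \<comment> \<open>By \<open>homogeneous_socle\<close> both components of \<open>f w\<close> lie in
    \<open>ppowers m\<close>; then \<open>onto\<close> and injectivity give the same for
    \<open>w\<close>. The choice of \<open>B\<close> splits \<open>w\<close> as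
    \<open>b \<otimes> t\<close>, and \<open>b\<close> is trivial because \<open>w\<close> and
    \<open>t\<close> lie in \<open>C\<close>.\<close>
  have key: "w \<in> ppowers (Suc m) \<and> \<rho> (f w) = \<one>"
    if w: "w \<in> socle" "w \<in> C" and fw: "\<pi> (f w) \<in> ppowers (Suc m)" for w
  proof -
    have fs: "f w \<in> socle"
      using w(1) by (rule hom_socle[OF f(1)])
    have \<rho>s: "\<rho> (f w) \<in> socle"
      using fs by (rule hom_socle[OF pr(2)])
    have "\<rho> (f w) \<in> ppowers m"
      using homogeneous_socle[OF B(1) _ \<rho>s] pr(4) sc fs by blast
    then have "f w \<in> ppowers m"
      using pr(5)[OF sc[OF fs]] fw ppSuc subgroup.m_closed[OF subgroup_ppowers] by (metis subsetD)
    then obtain w' where "w' \<in> socle \<inter> ppowers m" "f w = f w'"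
      using fs onto by blast
    then have "w \<in> ppowers m"
      using f(2) w(1) sc by (metis IntD1 IntD2 inj_onD)
    then obtain b t where bt: "b \<in> B" "t \<in> ppowers (Suc m)" "w = b \<otimes> t"
      using w(1) B(2) mem_set_mult_iff by blast
    have carr: "b \<in> carrier G" "t \<in> carrier G"
      using bt subgroup.mem_carrier[OF sub] subgroup.mem_carrier[OF subgroup_ppowers] by blast+
    have "b \<in> C"
      using subgroup_mult_cancel[OF C(1), of t b] bt w(2) C(2) carr m_comm by auto
    then have "b = \<one>"
      using bt(1) C(3) by blast
    then have wm: "w \<in> ppowers (Suc m)"
      using bt carr by simp
    then have "f w \<in> C"
      using hom_ppowers[OF f(1)] C(2) by blast
    then have "\<rho> (f w) \<in> C"
      using subgroup_mult_cancel[OF C(1), of "\<pi> (f w)" "\<rho> (f w)"] pr(3,5) closed sc fs by metis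
    then have "\<rho> (f w) = \<one>"
      using C(3) pr(4)[OF sc[OF fs]] by blast
    then show ?thesis using wm by blast
  qed
  \<comment> \<open>\<open>f\<close> itself may be onto on the socle; replacing it by the identity on \<open>B\<close> makes \<open>g\<close> miss \<open>u\<close>.\<close>
  define g where "g x = \<pi> (f (\<pi> x)) \<otimes> \<rho> x" for x
  have g: "g \<in> hom G G"
  proof (rule homI)
    fix x y assume xy: "x \<in> carrier G" "y \<in> carrier G"
    show "g x \<in> carrier G"
      unfolding g_def using xy closed by simp
    show "g (x \<otimes> y) = g x \<otimes> g y"
      unfolding g_def using xy closed hom_mult[OF f(1)] hom_mult[OF pr(1)] hom_mult[OF pr(2)]
      by (simp add: m_ac)
  qed
  have split: "\<pi> (f (\<pi> x)) = c \<and> \<rho> x = \<one>" if x: "x \<in> carrier G" "g x = c" "c \<in> C" for x c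
    using internal_product_unique[OF C(1) sub C(3), of "\<pi> (f (\<pi> x))" c "\<rho> x" \<one>]
      x pr(3,4) closed subgroup.one_closed[OF sub] subgroup.mem_carrier[OF C(1)]
    unfolding g_def by simp
  \<comment> \<open>On such \<open>x\<close> the maps \<open>f\<close> and \<open>g\<close> agree.
    The value \<open>c = \<one>\<close> yields injectivity of \<open>g\<close>, and
    \<open>c = u\<close> shows that \<open>g\<close> misses \<open>u\<close>.\<close>
  have main: "x \<in> ppowers (Suc m) \<and> f x = c"
    if x: "x \<in> socle" "g x = c" "c \<in> ppowers (Suc m)" for x c
  proof -
    have *: "\<pi> (f (\<pi> x)) = c" "\<rho> x = \<one>"
      using split[OF sc[OF x(1)] x(2)] x(3) C(2) by auto
    then have px: "x = \<pi> x"
      using pr(5) closed sc[OF x(1)] by (metis r_one)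
    then have "x \<in> C"
      using pr(3) sc[OF x(1)] by metis
    then have "x \<in> ppowers (Suc m)" "\<rho> (f x) = \<one>"
      using key[OF x(1)] * px x(3) by auto
    moreover have "f x = c"
      using pr(5)[of "f x"] closed sc[OF x(1)] *(1) px calculation(2) by (metis r_one)
    ultimately show ?thesis by blast
  qed
  show ?thesis
  proof (rule not_bassian_finite_not_surj_socle[OF g])
    show inj: "inj_on g (carrier G)"
    proof (rule inj_on_if_socle[OF g])
      fix x assume "x \<in> socle" "g x = \<one>"
      then have "f x = f \<one>" "x \<in> carrier G"
        using main subgroup.one_closed[OF subgroup_ppowers] hom_one'[OF f(1)] sc by auto
      then show "x = \<one>"
        using f(2) by (meson inj_onD one_closed)
    qed
    show "u \<notin> g ` carrier G"
    proof
      assume "u \<in> g ` carrier G"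
      then obtain x where x: "x \<in> carrier G" "g x = u"
        by blast
      then have "x \<in> socle"
        using u(1) mono_socle_iff[OF g inj] by blast
      then show False
        using main[of x u] x(2) u by blast
    qed
    show "u \<in> socle" using u by blast
  qed
qed

lemma bassian_finite_imp_co_hopfian:
  assumes "bassian_finite G"
  shows "co_hopfian G"
proof (rule ccontr)
  assume "\<not> co_hopfian G"
  then obtain H f where H: "subgroup H G" "H \<noteq> carrier G" and f: "f \<in> iso G (G\<lparr>carrier := H\<rparr>)"
    unfolding co_hopfian_def is_iso_def by blast
  have hom: "f \<in> hom G G" and inj: "inj_on f (carrier G)" and im: "f ` carrier G \<noteq> carrier G"
    using f H subgroup.subset[OF H(1)] by (auto simp: iso_def hom_def bij_betw_def)
  let ?onto = "\<lambda>n. socle \<inter> ppowers n \<subseteq> f ` (socle \<inter> ppowers n)"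
  obtain n where n: "\<not> ?onto n"
    using surj_if_heights_preserved[OF hom] im by blast
  show False
  \<comment> \<open>As \<open>ppowers 0\<close> is the whole group, \<open>?onto 0\<close> says that
    \<open>f\<close> maps the socle onto itself. If it holds, the failure at \<open>n\<close> gives
    consecutive levels where the property breaks.\<close>
  proof (cases "?onto 0")
    case True
    then obtain m where "?onto m" "\<not> ?onto (Suc m)"
      using n nat_last_step[of ?onto n] by blast
    then show False
      using not_bassian_finite_heights_raised[OF hom inj] assms by blast
  next
    case False
    then obtain v where v: "v \<in> socle" "v \<notin> f ` socle"
      by (auto simp: ppowers_0 socle_def)
    \<comment> \<open>By injectivity, any preimage of an element of the socle is itself in the
      socle.\<close>
    have "v \<notin> f ` carrier G"
      using v mono_socle_iff[OF hom inj] by blast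
    then show False
      using not_bassian_finite_not_surj_socle[OF hom inj v(1)] assms by blast
  qed
qed

end

section \<open>The two direct implications and the equivalence\<close>

lemma (in group) co_hopfian_imp_relatively_co_hopfian:
  assumes "co_hopfian G"
  shows "relatively_co_hopfian G"
  unfolding relatively_co_hopfian_def
proof
  fix \<phi> assume \<phi>: "\<phi> \<in> mon G G"
  then have hom: "\<phi> \<in> hom G G" and inj: "inj_on \<phi> (carrier G)"
    by (auto simp: mon_def)
  have sub: "subgroup (\<phi> ` carrier G) G"
    by (rule group_hom.img_is_subgroup) (auto simp: group_hom_def group_hom_axioms_def hom)
  have "\<phi> \<in> iso G (G\<lparr>carrier := \<phi> ` carrier G\<rparr>)"
    using hom inj by (auto simp: iso_def hom_def bij_betw_def)
  then have "\<phi> ` carrier G = carrier G"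
    using assms sub unfolding co_hopfian_def is_iso_def by blast
  then show "essential_subgroup (\<phi> ` carrier G) G"
    unfolding essential_subgroup_def using subgroup_self subgroup.subset by (metis inf.absorb_iff2)
qed

text \<open>An embedding into a summand \<open>A\<close> has an image that meets the complement
  \<open>B\<close> trivially, so essentiality forces \<open>B\<close> to be trivial.\<close>

lemma (in group) relatively_co_hopfian_imp_bassian_finite:
  assumes "relatively_co_hopfian G"
  shows "bassian_finite G"
  unfolding bassian_finite_def
proof (rule notI, elim exE conjE)
  fix A assume A: "direct_summand A G" "A \<noteq> carrier G" "mon G (G\<lparr>carrier := A\<rparr>) \<noteq> {}"
  then obtain B where B: "subgroup A G" "subgroup B G" "A \<inter> B = {\<one>}" "A <#> B = carrier G"
    unfolding direct_summand_def by blast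
  obtain \<phi> where \<phi>: "\<phi> \<in> mon G (G\<lparr>carrier := A\<rparr>)"
    using A(3) by blast
  then have im: "\<phi> ` carrier G \<subseteq> A"
    by (auto simp: mon_def hom_def)
  then have "\<phi> \<in> mon G G"
    using \<phi> subgroup.subset[OF B(1)] by (auto simp: mon_def hom_def)
  then have ess: "essential_subgroup (\<phi> ` carrier G) G"
    using assms by (simp add: relatively_co_hopfian_def)
  then have "\<one> \<in> \<phi> ` carrier G"
    unfolding essential_subgroup_def using subgroup.one_closed by blast
  then have "\<phi> ` carrier G \<inter> B = {\<one>}"
    using im B(2,3) subgroup.one_closed[OF B(2)] by blast
  then have "B = {\<one>}"
    using ess B(2) unfolding essential_subgroup_def by blast
  then have "carrier G = A"
    using B(4) subgroup.mem_carrier[OF B(1)] by (auto simp: set_mult_def)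
  then show False
    using A(2) by simp
qed

theorem proposition2p2:
  fixes p :: nat and T :: "('a, 'b) monoid_scheme"
  assumes "Factorial_Ring.prime p" and "comm_group T" and "p_group p T"
  shows "(bassian_finite T \<longleftrightarrow> co_hopfian T) \<and>
         (co_hopfian T \<longleftrightarrow> relatively_co_hopfian T)"
proof -
  interpret comm_group T by fact
  interpret comm_p_group T p
  proof
    show "Factorial_Ring.prime p" by fact
    show "\<exists>n. x [^]\<^bsub>T\<^esub> (p ^ n) = \<one>\<^bsub>T\<^esub>" if "x \<in> carrier T" for x
      using that assms(3) pow_ord_eq_1 unfolding p_group_def by metis
  qed
  show ?thesis
    using bassian_finite_imp_co_hopfian co_hopfian_imp_relatively_co_hopfian
      relatively_co_hopfian_imp_bassian_finite by blast
qed

end
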